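(* Let $(E,\|\cdot\|)$ be a real Banach space, $r\in(0,\infty)$, and let $X$ be a Radon $E$-valued random variable with $\mathbb E\|X\|^r<\infty$. Assume that $\mathbb P_X(F)=1$ for some Banach subspace $F$ of $E$. (a) For every $n\in\mathbb N$, $$e_{n,r}(X,E)\le e_{n,r}(X,F)\le 2\,e_{n,r}(X,E).$$ (b) If $F$ is locally $c$-complemented in $E$ (for some $c\ge 1$), then for every $n\in\mathbb N$, $$e_{n,r}(X,F)\le c\,e_{n,r}(X,E).$$
   Context: $X$ is a Radon $E$-valued random variable if it is defined on a probability space $(\Omega,\mathcal A,\mathbb P)$, is Borel measurable, and its distribution $\mathbb P_X$ is a Radon (equivalently, on Banach spaces, tight) probability measure on $E$. Since $\mathbb P_X(F)=1$, $X$ is also Radon when viewed as an $F$-valued random variable. For $G\in\{E,F\}$, the minimal $n$th $L^r$-quantization error is $$e_{n,r}(X,G):=\inf\Big\{\big(\mathbb E\min_{a\in\alpha}\|X-a\|^r\big)^{1/r}:\alpha\subset G,\ 1\le\mathrm{card}(\alpha)\le n\Big\}.$$ A Banach subspace of $E$ is a closed linear subspace with the induced norm. A Banach subspace $F$ of $E$ is called locally $c$-complemented in $E$ ($c\ge1$) if there is a linear operator $S:E\to F^{**}$ of norm $\|S\|\le c$ satisfying $S(x)=x$ for every $x\in F$, where $F$ is canonically embedded in its bidual $F^{**}$. *)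

theory Defs
  imports "HOL-Probability.Probability"
begin

text \<open>
  The ambient Banach space \<open>E\<close> is a type of class \<^class>\<open>banach\<close>; a Banach subspace \<open>F\<close> of it
  is a set, carrying the norm of \<open>E\<close>.
\<close>

definition banach_subspace :: "'a::banach set \<Rightarrow> bool" where
  "banach_subspace F \<longleftrightarrow> subspace F \<and> closed F"

definition radon_prob_measure :: "'a::banach measure \<Rightarrow> bool" where
  "radon_prob_measure \<mu> \<longleftrightarrow> prob_space \<mu> \<and> sets \<mu> = sets borel \<and>
     (\<forall>B\<in>sets borel. emeasure \<mu> B = (SUP K\<in>{K. compact K \<and> K \<subseteq> B}. emeasure \<mu> K))"

definition radon_random_variable :: "'w measure \<Rightarrow> ('w \<Rightarrow> 'a::banach) \<Rightarrow> bool" where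
  "radon_random_variable M X \<longleftrightarrow>
     prob_space M \<and> X \<in> borel_measurable M \<and> radon_prob_measure (distr M borel X)"

text \<open>
  The expectation is a Bochner integral, hence \<open>0\<close> for a non-integrable integrand; the value below is
  meaningful when \<open>norm X powr r\<close> is integrable. The condition \<open>1 \<le> card \<alpha>\<close> forces \<open>\<alpha>\<close> to be finite
  and nonempty.
\<close>

definition quantization_error ::
    "'w measure \<Rightarrow> nat \<Rightarrow> real \<Rightarrow> ('w \<Rightarrow> 'a::banach) \<Rightarrow> 'a set \<Rightarrow> real" where
  "quantization_error M n r X G =
     (INF \<alpha>\<in>{\<alpha>. \<alpha> \<subseteq> G \<and> 1 \<le> card \<alpha> \<and> card \<alpha> \<le> n}.
        (\<integral>\<omega>. Min ((\<lambda>a. norm (X \<omega> - a) powr r) ` \<alpha>) \<partial>M) powr (1 / r))"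

text \<open>
  Since \<open>F\<close> is a set, its dual and bidual are formed on explicit carriers. For a normed space with
  carrier \<open>V\<close>, operations \<open>add\<close> and \<open>smul\<close> and norm \<open>nrm\<close>, the bounded linear functionals on \<open>V\<close>
  are represented by functions on the whole type that vanish outside \<open>V\<close>, so that each functional
  has exactly one representative and the vector space operations are the pointwise ones.
\<close>

definition bounded_functionals ::
    "'v set \<Rightarrow> ('v \<Rightarrow> 'v \<Rightarrow> 'v) \<Rightarrow> (real \<Rightarrow> 'v \<Rightarrow> 'v) \<Rightarrow> ('v \<Rightarrow> real) \<Rightarrow> ('v \<Rightarrow> real) set" where
  "bounded_functionals V add smul nrm =
     {f. (\<forall>x. x \<notin> V \<longrightarrow> f x = 0) \<and>
         (\<forall>x\<in>V. \<forall>y\<in>V. f (add x y) = f x + f y) \<and>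
         (\<forall>t. \<forall>x\<in>V. f (smul t x) = t * f x) \<and>
         (\<exists>K. \<forall>x\<in>V. \<bar>f x\<bar> \<le> K * nrm x)}"

definition functional_norm :: "'v set \<Rightarrow> ('v \<Rightarrow> real) \<Rightarrow> ('v \<Rightarrow> real) \<Rightarrow> real" where
  "functional_norm V nrm f = (SUP x\<in>{x\<in>V. nrm x \<le> 1}. \<bar>f x\<bar>)"

definition dual :: "'a::banach set \<Rightarrow> ('a \<Rightarrow> real) set" where
  "dual F = bounded_functionals F (+) (*\<^sub>R) norm"

definition dual_norm :: "'a::banach set \<Rightarrow> ('a \<Rightarrow> real) \<Rightarrow> real" where
  "dual_norm F = functional_norm F norm"

definition bidual :: "'a::banach set \<Rightarrow> (('a \<Rightarrow> real) \<Rightarrow> real) set" where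
  "bidual F =
     bounded_functionals (dual F) (\<lambda>f g x. f x + g x) (\<lambda>t f x. t * f x) (dual_norm F)"

definition bidual_norm :: "'a::banach set \<Rightarrow> (('a \<Rightarrow> real) \<Rightarrow> real) \<Rightarrow> real" where
  "bidual_norm F = functional_norm (dual F) (dual_norm F)"

definition canonical_embedding :: "'a::banach set \<Rightarrow> 'a \<Rightarrow> ('a \<Rightarrow> real) \<Rightarrow> real" where
  "canonical_embedding F x = (\<lambda>f. if f \<in> dual F then f x else 0)"

definition locally_complemented :: "real \<Rightarrow> 'a::banach set \<Rightarrow> bool" where
  "locally_complemented c F \<longleftrightarrow>
     (\<exists>S :: 'a \<Rightarrow> ('a \<Rightarrow> real) \<Rightarrow> real.
        (\<forall>x. S x \<in> bidual F) \<and>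
        (\<forall>x y. S (x + y) = (\<lambda>f. S x f + S y f)) \<and>
        (\<forall>t x. S (t *\<^sub>R x) = (\<lambda>f. t * S x f)) \<and>
        (\<forall>x. bidual_norm F (S x) \<le> c * norm x) \<and>
        (\<forall>x\<in>F. S x = canonical_embedding F x))"

end

theory Submission
  imports Defs "HOL-Library.Function_Algebras"
begin

text \<open>
  Enlarging the set of admissible codebooks can only lower the infimum, so the error over \<open>E\<close> is at
  most the error over \<open>F\<close>. For the two upper bounds the task is to replace a codebook in \<open>E\<close> by one
  in \<open>F\<close> of the same size. Both bounds follow from one finite property of \<open>F\<close> with a constant \<open>c\<close>,
  called local retraction below: for every \<open>a\<close> in \<open>E\<close>, every finite \<open>T \<subseteq> F\<close> and every \<open>\<eta> > 0\<close> some
  \<open>b\<close> in \<open>F\<close> satisfies \<open>norm (t - b) \<le> c * norm (t - a) + \<eta>\<close> for all \<open>t\<close> in \<open>T\<close>.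

  Local retraction implies the bound with factor \<open>c\<close> (\<open>quantization_error_le_of_local_retraction\<close>).
  A finite net extends the inequality to a compact part of \<open>F\<close>, up to a small error. Since the law of
  \<open>X\<close> is Radon and \<open>F\<close> has full measure, \<open>X\<close> almost surely lies in all but finitely many members of
  a sequence of compact subsets of \<open>F\<close>. Putting \<open>0\<close> into the compact sets keeps the points \<open>b\<close>
  bounded, so off the compact sets the new error is dominated by one fixed integrable function, and
  dominated convergence finishes the proof.

  With \<open>c = 2\<close> the property holds for every \<open>F\<close>: take for \<open>b\<close> a nearly closest point to \<open>a\<close> and use
  the triangle inequality (\<open>nearest_point_local_retraction\<close>).

  Let \<open>F\<close> be locally \<open>c\<close>-complemented through \<open>S\<close>. If no suitable \<open>b\<close> existed, the point \<open>(t)\<close> of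
  \<open>E\<^sup>T\<close> would have distance at least \<open>1\<close> from the diagonal \<open>{(b, \<dots>, b) | b \<in> F}\<close> in the maximum norm
  with weights \<open>1 / d t\<close>, where \<open>d t = c * norm (t - a) + \<eta>\<close>. The Hahn-Banach theorem yields
  functionals \<open>f t\<close> that sum to zero on \<open>F\<close>, with \<open>\<Sum>t. f t t \<ge> 1\<close> and \<open>\<Sum>t. d t * norm (f t) \<le> 1\<close>
  (\<open>separate_from_diagonal\<close>). Evaluating at \<open>S a\<close>, which annihilates \<open>\<Sum>t. f t\<close>, gives
  \<open>1 \<le> \<Sum>t. (S (t - a)) (f t) \<le> \<Sum>t. c * norm (t - a) * norm (f t)\<close>. The \<open>f t\<close> do not all
  vanish on \<open>F\<close>, so the last sum is strictly smaller than \<open>\<Sum>t. d t * norm (f t) \<le> 1\<close>, a contradiction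
  (\<open>locally_complemented_local_retraction\<close>).
\<close>

section \<open>The Hahn-Banach theorem for sublinear functionals\<close>

lemma le_cINF_add:
  fixes f :: "'i \<Rightarrow> real" and g :: "'j \<Rightarrow> real"
  assumes "A \<noteq> {}" "B \<noteq> {}" "\<And>s t. s \<in> A \<Longrightarrow> t \<in> B \<Longrightarrow> c \<le> f s + g t"
  shows "c \<le> (INF s\<in>A. f s) + (INF t\<in>B. g t)"
proof -
  have "c - (INF s\<in>A. f s) \<le> (INF t\<in>B. g t)"
  proof (rule cINF_greatest[OF assms(2)])
    fix t assume t: "t \<in> B"
    have "c - g t \<le> (INF s\<in>A. f s)"
      using assms(3)[OF _ t] by (intro cINF_greatest[OF assms(1)]) (simp add: algebra_simps)
    then show "c - (INF s\<in>A. f s) \<le> g t" by simp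
  qed
  then show ?thesis by simp
qed

lemma le_mult_cINF:
  fixes f :: "'i \<Rightarrow> real"
  assumes "A \<noteq> {}" "0 < t" "\<And>s. s \<in> A \<Longrightarrow> c \<le> t * f s"
  shows "c \<le> t * (INF s\<in>A. f s)"
proof -
  have "c / t \<le> (INF s\<in>A. f s)"
    using assms by (intro cINF_greatest) (simp_all add: field_simps)
  then show ?thesis using assms(2) by (simp add: field_simps)
qed

definition sublinear :: "('v::real_vector \<Rightarrow> real) \<Rightarrow> bool" where
  "sublinear p \<longleftrightarrow>
     (\<forall>u v. p (u + v) \<le> p u + p v) \<and> (\<forall>t u. 0 < t \<longrightarrow> p (t *\<^sub>R u) \<le> t * p u)"

lemma sublinear_add: "sublinear p \<Longrightarrow> p (u + v) \<le> p u + p v"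
  by (simp add: sublinear_def)

lemma sublinear_scale:
  assumes "sublinear p" "0 \<le> t"
  shows "p (t *\<^sub>R u) = t * p u"
proof (cases "t = 0")
  case True
  have "p 0 \<le> p 0 + p 0" "p 0 \<le> 1/2 * p 0"
    using assms(1) sublinear_add[of p 0 0] unfolding sublinear_def
    by (simp, metis half_gt_zero_iff scaleR_zero_right zero_less_one)
  then show ?thesis using True by simp
next
  case False
  then have t: "0 < t" using assms(2) by simp
  have "p (inverse t *\<^sub>R (t *\<^sub>R u)) \<le> inverse t * p (t *\<^sub>R u)"
    using assms(1) t unfolding sublinear_def by (meson positive_imp_inverse_positive)
  then have "t * p u \<le> p (t *\<^sub>R u)" using t by (simp add: field_simps)
  moreover have "p (t *\<^sub>R u) \<le> t * p u" using assms(1) t unfolding sublinear_def by blast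
  ultimately show ?thesis by simp
qed

lemma sublinear_zero: "sublinear p \<Longrightarrow> p 0 = 0"
  using sublinear_scale[of p 0 0] by simp

lemma sublinear_minus: "sublinear p \<Longrightarrow> - p (- v) \<le> p v"
  using sublinear_add[of p v "- v"] by (simp add: sublinear_zero)

text \<open>
  One step of the descent to a linear functional: a sublinear functional can be lowered until it is
  as small at \<open>- x\<close> as linearity would force, given the value at \<open>x\<close>. The infimum over translates along
  the ray through \<open>x\<close> achieves this and stays finite because \<open>p\<close> dominates \<open>- p (- v)\<close>.
\<close>

lemma sublinear_tilt:
  fixes p :: "'v::real_vector \<Rightarrow> real"
  assumes p: "sublinear p"
  obtains q where "sublinear q" "\<And>v. q v \<le> p v" "q (- x) \<le> - p x"
proof
  define q where "q v = (INF t\<in>{0::real..}. p (v + t *\<^sub>R x) - t * p x)" for v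
  have bdd: "bdd_below ((\<lambda>t. p (v + t *\<^sub>R x) - t * p x) ` {0..})" for v
  proof (rule bdd_belowI2)
    fix t :: real assume "t \<in> {0..}"
    then show "- p (- v) \<le> p (v + t *\<^sub>R x) - t * p x"
      using sublinear_add[OF p, of "v + t *\<^sub>R x" "- v"] sublinear_scale[OF p, of t x] by simp
  qed
  have le: "q v \<le> p (v + t *\<^sub>R x) - t * p x" if "0 \<le> t" for v t
    unfolding q_def by (rule cINF_lower[OF bdd]) (use that in simp)
  show "sublinear q" unfolding sublinear_def
  proof (intro conjI allI impI)
    fix u v
    show "q (u + v) \<le> q u + q v" unfolding q_def[of u] q_def[of v]
    proof (rule le_cINF_add)
      fix s t :: real assume "s \<in> {0..}" "t \<in> {0..}"
      then show "q (u + v) \<le> (p (u + s *\<^sub>R x) - s * p x) + (p (v + t *\<^sub>R x) - t * p x)"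
        using le[of "s + t" "u + v"] sublinear_add[OF p, of "u + s *\<^sub>R x" "v + t *\<^sub>R x"]
        by (simp add: algebra_simps)
    qed auto
  next
    fix t u assume t: "0 < (t::real)"
    show "q (t *\<^sub>R u) \<le> t * q u" unfolding q_def[of u]
    proof (rule le_mult_cINF)
      fix s :: real assume s: "s \<in> {0..}"
      have "p (t *\<^sub>R u + (t * s) *\<^sub>R x) = t * p (u + s *\<^sub>R x)"
        using sublinear_scale[OF p, of t "u + s *\<^sub>R x"] t by (simp add: scaleR_add_right)
      then show "q (t *\<^sub>R u) \<le> t * (p (u + s *\<^sub>R x) - s * p x)"
        using le[of "t * s" "t *\<^sub>R u"] s t by (simp add: algebra_simps)
    qed (use t in auto)
  qed
  show "q v \<le> p v" for v using le[of 0 v] by simp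
  show "q (- x) \<le> - p x" using le[of 1 "- x"] sublinear_zero[OF p] by simp
qed

text \<open>
  A minimal sublinear functional cannot be tilted any further in any direction, hence is odd. Applying
  subadditivity to \<open>- u\<close> and \<open>- v\<close> then gives the reverse inequality, so it is additive.
\<close>

lemma minimal_sublinear_linear:
  assumes m: "sublinear m" and min: "\<And>q. sublinear q \<Longrightarrow> (\<And>v. q v \<le> m v) \<Longrightarrow> q = m"
  shows "linear m"
proof -
  have odd: "m (- x) = - m x" for x
  proof -
    obtain q where "sublinear q" "\<And>v. q v \<le> m v" "q (- x) \<le> - m x"
      using sublinear_tilt[OF m] by blast
    with min have "m (- x) \<le> - m x" by blast
    with sublinear_minus[OF m, of x] show ?thesis by simp
  qed
  show ?thesis
  proof (rule linearI)
    fix u v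
    have "m (- u + - v) \<le> m (- u) + m (- v)" by (rule sublinear_add[OF m])
    then have "m u + m v \<le> m (u + v)" using odd[of "u + v"] odd[of u] odd[of v] by simp
    with sublinear_add[OF m, of u v] show "m (u + v) = m u + m v" by simp
  next
    fix t u
    show "m (t *\<^sub>R u) = t *\<^sub>R m u"
    proof (cases "0 \<le> t")
      case True
      then show ?thesis by (simp add: sublinear_scale[OF m])
    next
      case False
      then have "m ((- t) *\<^sub>R u) = - t * m u" by (intro sublinear_scale[OF m]) simp
      then show ?thesis using odd[of "t *\<^sub>R u"] by simp
    qed
  qed
qed

text \<open>
  This supplies the lower bounds of chains that Zorn's lemma needs. The infimum is subadditive because
  of any two members of a chain one lies below the other, and that one can be used for both summands.
\<close>

lemma chain_Inf_sublinear:
  fixes C :: "('v::real_vector \<Rightarrow> real) set"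
  assumes ne: "C \<noteq> {}" and sub: "\<And>q. q \<in> C \<Longrightarrow> sublinear q"
    and le: "\<And>q v. q \<in> C \<Longrightarrow> q v \<le> p v"
    and chain: "\<And>q q'. q \<in> C \<Longrightarrow> q' \<in> C \<Longrightarrow> (\<forall>v. q v \<le> q' v) \<or> (\<forall>v. q' v \<le> q v)"
  shows "sublinear (\<lambda>v. INF q\<in>C. q v)" "\<And>q v. q \<in> C \<Longrightarrow> (INF q\<in>C. q v) \<le> q v"
proof -
  have "bdd_below ((\<lambda>q. q v) ` C)" for v
  proof (rule bdd_belowI2)
    fix q assume "q \<in> C"
    then show "- p (- v) \<le> q v"
      using sublinear_minus[OF sub, of q v] le[of q "- v"] by simp
  qed
  then show lower: "(INF q\<in>C. q v) \<le> q v" if "q \<in> C" for q v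
    using that by (rule cINF_lower)
  show "sublinear (\<lambda>v. INF q\<in>C. q v)" unfolding sublinear_def
  proof (intro conjI allI impI)
    fix u v
    show "(INF q\<in>C. q (u + v)) \<le> (INF q\<in>C. q u) + (INF q\<in>C. q v)"
    proof (rule le_cINF_add[OF ne ne])
      fix q q' assume q: "q \<in> C" "q' \<in> C"
      from chain[OF q] show "(INF q\<in>C. q (u + v)) \<le> q u + q' v"
      proof
        assume "\<forall>v. q v \<le> q' v"
        then show ?thesis
          using lower[OF q(1), of "u + v"] sublinear_add[OF sub[OF q(1)], of u v] by (smt (verit))
      next
        assume "\<forall>v. q' v \<le> q v"
        then show ?thesis
          using lower[OF q(2), of "u + v"] sublinear_add[OF sub[OF q(2)], of u v] by (smt (verit))
      qed
    qed
  next
    fix t u assume t: "0 < (t::real)"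
    show "(INF q\<in>C. q (t *\<^sub>R u)) \<le> t * (INF q\<in>C. q u)"
    proof (rule le_mult_cINF[OF ne t])
      fix q assume q: "q \<in> C"
      show "(INF q\<in>C. q (t *\<^sub>R u)) \<le> t * q u"
        using lower[OF q, of "t *\<^sub>R u"] sublinear_scale[OF sub[OF q], of t u] t by simp
    qed
  qed
qed

text \<open>
  Tilting \<open>p\<close> along \<open>x\<close> before taking a minimal sublinear functional below it forces the linear
  functional to attain \<open>p x\<close>: its value at \<open>- x\<close> is then at most \<open>- p x\<close>.
\<close>

theorem Hahn_Banach_sublinear:
  fixes p :: "'v::real_vector \<Rightarrow> real"
  assumes p: "sublinear p"
  obtains \<Lambda> where "linear \<Lambda>" "\<And>v. \<Lambda> v \<le> p v" "\<Lambda> x = p x"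
proof -
  obtain p' where p': "sublinear p'" "\<And>v. p' v \<le> p v" "p' (- x) \<le> - p x"
    using sublinear_tilt[OF p] by blast
  define A where "A = {q. sublinear q \<and> (\<forall>v. q v \<le> p' v)}"
  define P where "P q q' \<longleftrightarrow> (\<forall>v. q' v \<le> q v)" for q q' :: "'v \<Rightarrow> real"
  have "\<exists>m\<in>A. \<forall>q\<in>A. P m q \<longrightarrow> q = m"
  proof (rule predicate_Zorn)
    show "partial_order_on A (relation_of P A)"
    proof (rule partial_order_on_relation_ofI)
      show "a = b" if "P a b" "P b a" for a b
        using that unfolding P_def by (intro ext antisym) auto
    qed (auto simp: P_def intro: order_trans)
    fix C assume C: "C \<in> Chains (relation_of P A)"
    show "\<exists>u\<in>A. \<forall>q\<in>C. P q u"
    proof (cases "C = {}")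
      case True
      then show ?thesis using p'(1) by (auto simp: A_def)
    next
      case False
      have CA: "C \<subseteq> A" by (rule Chains_relation_of[OF C])
      have tot: "(\<forall>v. q v \<le> q' v) \<or> (\<forall>v. q' v \<le> q v)" if "q \<in> C" "q' \<in> C" for q q'
        using C that by (auto simp: Chains_def relation_of_def P_def)
      have sub: "sublinear q" "q v \<le> p' v" if "q \<in> C" for q v
        using that CA by (auto simp: A_def)
      have inf: "sublinear (\<lambda>v. INF q\<in>C. q v)" "(INF q\<in>C. q v) \<le> q v" if "q \<in> C" for q v
        using chain_Inf_sublinear[OF False, of p'] sub tot that by blast+
      obtain q where q: "q \<in> C" using False by blast
      have "(INF q\<in>C. q v) \<le> p' v" for v
        using inf(2)[OF q, of v] sub(2)[OF q, of v] by linarith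
      then have "(\<lambda>v. INF q\<in>C. q v) \<in> A"
        using inf(1)[OF q] by (simp add: A_def)
      moreover have "\<forall>q\<in>C. P q (\<lambda>v. INF q\<in>C. q v)"
        using inf(2) by (simp add: P_def)
      ultimately show ?thesis by blast
    qed
  qed
  then obtain m where m: "m \<in> A" "\<And>q. q \<in> A \<Longrightarrow> P m q \<Longrightarrow> q = m" by blast
  have lin: "linear m"
  proof (rule minimal_sublinear_linear)
    show "sublinear m" using m(1) by (simp add: A_def)
    fix q assume q: "sublinear q" "\<And>v. q v \<le> m v"
    have "q v \<le> p' v" for v using q(2)[of v] m(1) unfolding A_def by (force intro: order_trans)
    with q show "q = m" by (intro m(2)) (auto simp: A_def P_def)
  qed
  have mp: "m v \<le> p' v" for v using m(1) by (simp add: A_def)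
  have "m (- x) = - m x" using lin by (simp add: linear_neg)
  with mp[of "- x"] p'(3) have "p x \<le> m x" by simp
  moreover have "m v \<le> p v" for v using mp[of v] p'(2)[of v] by simp
  ultimately show ?thesis using that[OF lin] by (simp add: antisym)
qed

section \<open>Separating a family of points from the diagonal\<close>

text \<open>
  Finite families of vectors are to be handled as vectors themselves, with the pointwise operations.
\<close>

instantiation "fun" :: (type, real_vector) real_vector
begin

definition scaleR_fun :: "real \<Rightarrow> ('a \<Rightarrow> 'b) \<Rightarrow> 'a \<Rightarrow> 'b" where
  "scaleR_fun t f = (\<lambda>i. t *\<^sub>R f i)"

instance
  by standard (simp_all add: scaleR_fun_def fun_eq_iff scaleR_add_right scaleR_add_left)

end

lemma scaleR_fun_apply [simp]: "(t *\<^sub>R f) i = t *\<^sub>R f i"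
  by (simp add: scaleR_fun_def)

lemma linear_family_decomp:
  fixes \<Lambda> :: "('i \<Rightarrow> 'v::real_vector) \<Rightarrow> real"
  assumes "linear \<Lambda>" "finite I"
  shows "\<Lambda> (\<lambda>i. if i \<in> I then u i else 0) = (\<Sum>i\<in>I. \<Lambda> (\<lambda>j. if j = i then u i else 0))"
  using assms(2)
proof (induction I)
  case empty
  have "(\<lambda>i. 0) = (0 :: 'i \<Rightarrow> 'v)" by (simp add: fun_eq_iff)
  then show ?case using linear_0[OF assms(1)] by simp
next
  case (insert k I)
  have "(\<lambda>i. if i \<in> insert k I then u i else 0)
      = (\<lambda>j. if j = k then u k else 0) + (\<lambda>i. if i \<in> I then u i else 0)"
    using insert.hyps by (auto simp: fun_eq_iff)
  then show ?case
    using insert linear_add[OF assms(1)] by simp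
qed

text \<open>
  In the space of families, let \<open>N\<close> be the maximum norm over \<open>I\<close> with weights \<open>1 / d i\<close>, and let \<open>p\<close> be
  the \<open>N\<close>-distance to the diagonal copy of \<open>F\<close>. The assumption says that \<open>p x \<ge> 1\<close>. A linear functional
  below \<open>p\<close> that attains \<open>p x\<close> vanishes on the diagonal and is bounded by \<open>1\<close> on the unit ball of \<open>N\<close>;
  the functionals \<open>f i\<close> are its coordinates. The last conclusion is this bound on the
  unit ball; it says that the norms of the \<open>f i\<close>, weighted by \<open>d i\<close>, sum to at most \<open>1\<close>.
\<close>

lemma separate_from_diagonal:
  fixes F :: "'a::real_normed_vector set" and x :: "'i \<Rightarrow> 'a"
  assumes F: "subspace F" and I: "finite I" "I \<noteq> {}" and d: "\<And>i. i \<in> I \<Longrightarrow> 0 < d i"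
    and far: "\<And>b. b \<in> F \<Longrightarrow> \<exists>i\<in>I. d i \<le> norm (x i - b)"
  obtains f :: "'i \<Rightarrow> 'a \<Rightarrow> real"
  where "\<And>i. linear (f i)"
    and "\<And>b. b \<in> F \<Longrightarrow> (\<Sum>i\<in>I. f i b) = 0"
    and "1 \<le> (\<Sum>i\<in>I. f i (x i))"
    and "\<forall>u. (\<forall>i\<in>I. norm (u i) \<le> d i) \<longrightarrow> (\<Sum>i\<in>I. f i (u i)) \<le> 1"
proof -
  define N where "N v = Max ((\<lambda>i. norm (v i) / d i) ` I)" for v :: "'i \<Rightarrow> 'a"
  have N_le: "N v \<le> r \<longleftrightarrow> (\<forall>i\<in>I. norm (v i) / d i \<le> r)" for v r
    unfolding N_def using I by simp
  have N_ge: "norm (v i) / d i \<le> N v" if "i \<in> I" for v i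
    using N_le[of v "N v"] that by simp
  have N_nonneg: "0 \<le> N v" for v
  proof -
    obtain i where i: "i \<in> I" using I by blast
    show ?thesis using N_ge[OF i, of v] d[OF i] by (meson divide_nonneg_pos norm_ge_zero order_trans)
  qed
  have N_add: "N (\<lambda>i. u i + v i) \<le> N u + N v" for u v
    unfolding N_le
  proof
    fix i assume i: "i \<in> I"
    have "norm (u i + v i) / d i \<le> norm (u i) / d i + norm (v i) / d i"
      using d[OF i] norm_triangle_ineq[of "u i" "v i"] by (simp add: field_simps)
    with N_ge[OF i, of u] N_ge[OF i, of v]
    show "norm (u i + v i) / d i \<le> N u + N v" by linarith
  qed
  have N_scale: "N (\<lambda>i. t *\<^sub>R v i) \<le> t * N v" if "0 < t" for t v
    unfolding N_le using N_ge[of _ v] that by (simp add: mult_left_mono flip: times_divide_eq_right)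
  define p where "p v = (INF b\<in>F. N (\<lambda>i. v i - b))" for v
  have bdd: "bdd_below ((\<lambda>b. N (\<lambda>i. v i - b)) ` F)" for v
    using N_nonneg by (intro bdd_belowI2[of _ 0])
  have p_le: "p v \<le> N (\<lambda>i. v i - b)" if "b \<in> F" for v b
    unfolding p_def by (rule cINF_lower[OF bdd that])
  have F_ne: "F \<noteq> {}" using subspace_0[OF F] by blast
  have "sublinear p" unfolding sublinear_def
  proof (intro conjI allI impI)
    fix u v :: "'i \<Rightarrow> 'a"
    show "p (u + v) \<le> p u + p v" unfolding p_def[of u] p_def[of v]
    proof (rule le_cINF_add[OF F_ne F_ne])
      fix a b assume ab: "a \<in> F" "b \<in> F"
      have "p (u + v) \<le> N (\<lambda>i. (u i - a) + (v i - b))"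
        using p_le[OF subspace_add[OF F ab], of "u + v"] by (simp add: algebra_simps)
      then show "p (u + v) \<le> N (\<lambda>i. u i - a) + N (\<lambda>i. v i - b)"
        using N_add[of "\<lambda>i. u i - a" "\<lambda>i. v i - b"] by linarith
    qed
  next
    fix t :: real and u :: "'i \<Rightarrow> 'a" assume t: "0 < t"
    show "p (t *\<^sub>R u) \<le> t * p u" unfolding p_def[of u]
    proof (rule le_mult_cINF[OF F_ne t])
      fix b assume b: "b \<in> F"
      have "p (t *\<^sub>R u) \<le> N (\<lambda>i. t *\<^sub>R (u i - b))"
        using p_le[OF subspace_scale[OF F b], of "t *\<^sub>R u" t] by (simp add: algebra_simps)
      then show "p (t *\<^sub>R u) \<le> t * N (\<lambda>i. u i - b)"
        using N_scale[OF t, of "\<lambda>i. u i - b"] by linarith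
    qed
  qed
  \<comment> \<open>\<open>N\<close> ignores coordinates outside \<open>I\<close>; cutting them off makes the family a finite sum of its entries.\<close>
  define R where "R v = (\<lambda>i. if i \<in> I then v i else 0)" for v :: "'i \<Rightarrow> 'a"
  obtain \<Lambda> where \<Lambda>: "linear \<Lambda>" "\<And>v. \<Lambda> v \<le> p v" "\<Lambda> (R x) = p (R x)"
    using Hahn_Banach_sublinear[OF \<open>sublinear p\<close>] by blast
  define f where "f i v = \<Lambda> (\<lambda>j. if j = i then v else 0)" for i v
  have sum_f: "(\<Sum>i\<in>I. f i (u i)) = \<Lambda> (R u)" for u
    unfolding R_def f_def by (rule linear_family_decomp[OF \<Lambda>(1) I(1), symmetric])
  show ?thesis
  proof
    fix i show "linear (f i)"
    proof (rule linearI)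
      fix u v :: 'a
      have "(\<lambda>j. if j = i then u + v else 0) = (\<lambda>j. if j = i then u else 0) + (\<lambda>j. if j = i then v else 0)"
        by (auto simp: fun_eq_iff)
      then show "f i (u + v) = f i u + f i v" by (simp add: f_def linear_add[OF \<Lambda>(1)])
    next
      fix t :: real and u :: 'a
      have "(\<lambda>j. if j = i then t *\<^sub>R u else 0) = t *\<^sub>R (\<lambda>j. if j = i then u else 0)"
        by (auto simp: fun_eq_iff)
      then show "f i (t *\<^sub>R u) = t *\<^sub>R f i u" by (simp add: f_def linear_cmul[OF \<Lambda>(1)])
    qed
  next
    have le0: "\<Lambda> (R (\<lambda>_. b)) \<le> 0" if "b \<in> F" for b
    proof -
      have "N (\<lambda>i. R (\<lambda>_. b) i - b) \<le> 0" unfolding N_le by (simp add: R_def)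
      then show ?thesis using \<Lambda>(2)[of "R (\<lambda>_. b)"] p_le[OF that, of "R (\<lambda>_. b)"] by linarith
    qed
    fix b assume b: "b \<in> F"
    have "R (\<lambda>_. - b) = - R (\<lambda>_. b)" by (auto simp: R_def fun_eq_iff)
    with le0[OF subspace_neg[OF F b]] have "- \<Lambda> (R (\<lambda>_. b)) \<le> 0"
      by (simp add: linear_neg[OF \<Lambda>(1)])
    with le0[OF b] show "(\<Sum>i\<in>I. f i b) = 0" by (simp add: sum_f[of "\<lambda>_. b"])
  next
    have "1 \<le> p (R x)" unfolding p_def
    proof (rule cINF_greatest[OF F_ne])
      fix b assume "b \<in> F"
      then obtain i where i: "i \<in> I" "d i \<le> norm (x i - b)" using far by blast
      have "1 \<le> norm (R x i - b) / d i" using i d[OF i(1)] by (simp add: R_def)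
      with N_ge[OF i(1), of "\<lambda>i. R x i - b"] show "1 \<le> N (\<lambda>i. R x i - b)" by linarith
    qed
    then show "1 \<le> (\<Sum>i\<in>I. f i (x i))" using \<Lambda>(3) sum_f[of x] by simp
  next
    show "\<forall>u. (\<forall>i\<in>I. norm (u i) \<le> d i) \<longrightarrow> (\<Sum>i\<in>I. f i (u i)) \<le> 1"
    proof (intro allI impI)
      fix u :: "'i \<Rightarrow> 'a" assume u: "\<forall>i\<in>I. norm (u i) \<le> d i"
      have "N (\<lambda>i. R u i - 0) \<le> 1" unfolding N_le using u d by (simp add: R_def)
      then show "(\<Sum>i\<in>I. f i (u i)) \<le> 1"
        using \<Lambda>(2)[of "R u"] p_le[OF subspace_0[OF F], of "R u"] sum_f[of u] by linarith
    qed
  qed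
qed


section \<open>Duals and biduals on explicit carriers\<close>

lemma bounded_functionals_bdd_above:
  assumes f: "f \<in> bounded_functionals V add smul nrm"
    and nonneg: "\<And>y. y \<in> V \<Longrightarrow> 0 \<le> nrm y"
  shows "bdd_above ((\<lambda>y. \<bar>f y\<bar>) ` {y \<in> V. nrm y \<le> 1})"
proof -
  obtain K where K: "\<forall>y\<in>V. \<bar>f y\<bar> \<le> K * nrm y"
    using f unfolding bounded_functionals_def by blast
  show ?thesis
  proof (rule bdd_aboveI2)
    fix y assume y: "y \<in> {y \<in> V. nrm y \<le> 1}"
    then have "\<bar>f y\<bar> \<le> K * nrm y" using K by blast
    also have "\<dots> \<le> \<bar>K\<bar> * nrm y" using nonneg[of y] y by (intro mult_right_mono) auto
    also have "\<dots> \<le> \<bar>K\<bar>" using y nonneg[of y] by (simp add: mult_left_le)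
    finally show "\<bar>f y\<bar> \<le> \<bar>K\<bar>" .
  qed
qed

text \<open>
  Both the dual of \<open>F\<close> and its bidual are instances of \<^const>\<open>bounded_functionals\<close>. As the carrier has
  no vector space structure of its own, the possibility of normalizing a vector is an assumption here.
\<close>

lemma bounded_functionals_le_norm:
  assumes f: "f \<in> bounded_functionals V add smul nrm" and x: "x \<in> V"
    and nonneg: "\<And>y. y \<in> V \<Longrightarrow> 0 \<le> nrm y"
    and normalize: "\<And>y. y \<in> V \<Longrightarrow> 0 < nrm y \<Longrightarrow>
                      smul (1 / nrm y) y \<in> V \<and> nrm (smul (1 / nrm y) y) \<le> 1"
  shows "\<bar>f x\<bar> \<le> functional_norm V nrm f * nrm x"
proof (cases "nrm x = 0")
  case True
  obtain K where "\<forall>y\<in>V. \<bar>f y\<bar> \<le> K * nrm y"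
    using f unfolding bounded_functionals_def by blast
  with True x have "\<bar>f x\<bar> \<le> 0" by force
  with True show ?thesis by simp
next
  case False
  then have pos: "0 < nrm x" using nonneg[OF x] by simp
  have "\<bar>f (smul (1 / nrm x) x)\<bar> \<le> functional_norm V nrm f"
    unfolding functional_norm_def using normalize[OF x pos]
    by (intro cSUP_upper[OF _ bounded_functionals_bdd_above[OF f nonneg]]) auto
  moreover have "f (smul (1 / nrm x) x) = 1 / nrm x * f x"
    using f x unfolding bounded_functionals_def by blast
  ultimately show ?thesis using pos by (simp add: abs_mult field_simps)
qed

lemma dual_bounded: "f \<in> dual F \<Longrightarrow> \<exists>K. \<forall>x\<in>F. \<bar>f x\<bar> \<le> K * norm x"
  unfolding dual_def bounded_functionals_def by blast

lemma dual_scaleR: "f \<in> dual F \<Longrightarrow> x \<in> F \<Longrightarrow> f (t *\<^sub>R x) = t * f x"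
  unfolding dual_def bounded_functionals_def by blast

lemma bdd_above_dual: "f \<in> dual F \<Longrightarrow> bdd_above ((\<lambda>x. \<bar>f x\<bar>) ` {x \<in> F. norm x \<le> 1})"
  unfolding dual_def by (rule bounded_functionals_bdd_above) simp_all

lemma dual_norm_nonneg:
  assumes "subspace F" "f \<in> dual F"
  shows "0 \<le> dual_norm F f"
  unfolding dual_norm_def functional_norm_def
  by (rule cSUP_upper2[OF bdd_above_dual[OF assms(2)], of 0]) (use assms(1) subspace_0 in auto)

lemma dual_scale:
  assumes "f \<in> dual F"
  shows "(\<lambda>x. t * f x) \<in> dual F"
proof -
  obtain K where K: "\<forall>x\<in>F. \<bar>f x\<bar> \<le> K * norm x" using dual_bounded[OF assms] by blast
  have "\<forall>x\<in>F. \<bar>t * f x\<bar> \<le> (\<bar>t\<bar> * K) * norm x"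
    using K by (simp add: abs_mult mult.assoc mult_left_mono)
  then show ?thesis
    using assms unfolding dual_def bounded_functionals_def by (auto simp: distrib_left)
qed

lemma dual_add:
  assumes "f \<in> dual F" "g \<in> dual F"
  shows "(\<lambda>x. f x + g x) \<in> dual F"
proof -
  obtain K L where K: "\<forall>x\<in>F. \<bar>f x\<bar> \<le> K * norm x" and L: "\<forall>x\<in>F. \<bar>g x\<bar> \<le> L * norm x"
    using dual_bounded[OF assms(1)] dual_bounded[OF assms(2)] by blast
  have "\<forall>x\<in>F. \<bar>f x + g x\<bar> \<le> (K + L) * norm x"
    using K L by (auto simp: distrib_right intro: order_trans[OF abs_triangle_ineq] add_mono)
  then show ?thesis
    using assms unfolding dual_def bounded_functionals_def by (auto simp: distrib_left)
qed

lemma dual_norm_scale: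
  assumes F: "subspace F" and f: "f \<in> dual F"
  shows "dual_norm F (\<lambda>x. t * f x) \<le> \<bar>t\<bar> * dual_norm F f"
  unfolding dual_norm_def functional_norm_def
proof (rule cSUP_least)
  show "{x \<in> F. norm x \<le> 1} \<noteq> {}" using subspace_0[OF F] by fastforce
  fix x assume "x \<in> {x \<in> F. norm x \<le> 1}"
  then have "\<bar>f x\<bar> \<le> (SUP x\<in>{x \<in> F. norm x \<le> 1}. \<bar>f x\<bar>)"
    by (rule cSUP_upper[OF _ bdd_above_dual[OF f]])
  then show "\<bar>t * f x\<bar> \<le> \<bar>t\<bar> * (SUP x\<in>{x \<in> F. norm x \<le> 1}. \<bar>f x\<bar>)"
    by (simp add: abs_mult mult_left_mono)
qed

lemma bidual_le_norm:
  assumes F: "subspace F" and z: "z \<in> bidual F" and f: "f \<in> dual F"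
  shows "\<bar>z f\<bar> \<le> bidual_norm F z * dual_norm F f"
  unfolding bidual_norm_def
proof (rule bounded_functionals_le_norm[OF z[unfolded bidual_def] f])
  show "0 \<le> dual_norm F g" if "g \<in> dual F" for g using that by (rule dual_norm_nonneg[OF F])
  fix g assume g: "g \<in> dual F" and pos: "0 < dual_norm F g"
  have "dual_norm F (\<lambda>x. 1 / dual_norm F g * g x) \<le> \<bar>1 / dual_norm F g\<bar> * dual_norm F g"
    by (rule dual_norm_scale[OF F g])
  then show "(\<lambda>x. 1 / dual_norm F g * g x) \<in> dual F \<and>
      dual_norm F (\<lambda>x. 1 / dual_norm F g * g x) \<le> 1"
    using dual_scale[OF g, of "1 / dual_norm F g"] pos by simp
qed

lemma bidual_sum:
  assumes z: "z \<in> bidual F" and "finite J" and g: "\<And>j. j \<in> J \<Longrightarrow> g j \<in> dual F"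
  shows "(\<lambda>x. \<Sum>j\<in>J. g j x) \<in> dual F \<and> z (\<lambda>x. \<Sum>j\<in>J. g j x) = (\<Sum>j\<in>J. z (g j))"
  using assms(2) g
proof (induction J)
  case empty
  have zero: "(\<lambda>_. 0) \<in> dual F" by (auto simp: dual_def bounded_functionals_def intro: exI[of _ 0])
  have "\<forall>t. \<forall>h\<in>dual F. z (\<lambda>x. t * h x) = t * z h"
    using z unfolding bidual_def bounded_functionals_def by blast
  from this[rule_format, OF zero, of 0] have "z (\<lambda>_. 0) = 0" by simp
  then show ?case using zero by simp
next
  case (insert k J)
  then have IH: "(\<lambda>x. \<Sum>j\<in>J. g j x) \<in> dual F" "z (\<lambda>x. \<Sum>j\<in>J. g j x) = (\<Sum>j\<in>J. z (g j))"
    and k: "g k \<in> dual F" by auto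
  have "\<forall>h\<in>dual F. \<forall>h'\<in>dual F. z (\<lambda>x. h x + h' x) = z h + z h'"
    using z unfolding bidual_def bounded_functionals_def by blast
  from this[rule_format, OF k IH(1)]
  have "z (\<lambda>x. g k x + (\<Sum>j\<in>J. g j x)) = z (g k) + z (\<lambda>x. \<Sum>j\<in>J. g j x)" .
  then show ?case using insert.hyps IH dual_add[OF k IH(1)] by simp
qed

lemma restrict_linear_in_dual:
  fixes f :: "'a::banach \<Rightarrow> real"
  assumes F: "subspace F" and f: "linear f" and bound: "\<And>v. f v \<le> K * norm v"
  shows "(\<lambda>v. if v \<in> F then f v else 0) \<in> dual F"
proof -
  have "\<bar>f v\<bar> \<le> K * norm v" for v
    using bound[of v] bound[of "- v"] linear_neg[OF f, of v] by auto
  then show ?thesis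
    unfolding dual_def bounded_functionals_def
    using subspace_add[OF F] subspace_scale[OF F] linear_add[OF f] linear_cmul[OF f] by auto
qed

text \<open>
  The weak inequality holds for every \<open>g\<close> (with \<open>u = 0\<close> if the norm of \<open>g\<close> is zero), so one \<open>u\<close> can be
  chosen for each member of a finite family; a single nonzero member makes the sum strict.
\<close>

lemma dual_norm_nearly_attained:
  assumes F: "subspace F" and g: "g \<in> dual F" and less: "0 \<le> e" "e < d"
  obtains u where "u \<in> F" "norm u \<le> d" "e * dual_norm F g \<le> g u"
    "0 < dual_norm F g \<Longrightarrow> e * dual_norm F g < g u"
proof (cases "0 < dual_norm F g")
  case False
  then have "dual_norm F g = 0" using dual_norm_nonneg[OF F g] by simp
  moreover have "g 0 = 0"
  proof -
    show ?thesis using dual_scaleR[OF g subspace_0[OF F], of 0] by simp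
  qed
  ultimately show ?thesis using that[of 0] subspace_0[OF F] less by (simp add: less_imp_le)
next
  case True
  have "e / d * dual_norm F g < dual_norm F g"
    using True less by (simp add: field_simps)
  moreover have "{x \<in> F. norm x \<le> 1} \<noteq> {}" using subspace_0[OF F] by fastforce
  ultimately obtain v where v: "v \<in> F" "norm v \<le> 1" "e / d * dual_norm F g < \<bar>g v\<bar>"
    using less_cSUP_iff[OF _ bdd_above_dual[OF g]] unfolding dual_norm_def functional_norm_def
    by auto
  define t where "t = (if 0 \<le> g v then d else - d)"
  have "g (t *\<^sub>R v) = t * g v" by (rule dual_scaleR[OF g v(1)])
  also have "\<dots> = d * \<bar>g v\<bar>" by (simp add: t_def)
  finally have "e * dual_norm F g < g (t *\<^sub>R v)" using v(3) less by (simp add: field_simps)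
  moreover have "norm (t *\<^sub>R v) \<le> d" using v(2) less by (simp add: t_def mult_left_le)
  ultimately show ?thesis using that[of "t *\<^sub>R v"] subspace_scale[OF F v(1)] by simp
qed

section \<open>Local retractions onto a subspace\<close>

text \<open>
  A finite part of the principle of local reflexivity: \<open>S a\<close> lies in the bidual and is at distance at
  most \<open>c * norm (t - a)\<close> from each \<open>t\<close>, and a point of \<open>F\<close> itself does almost as well for finitely
  many \<open>t\<close>. Otherwise the separating functionals, whose restrictions to \<open>F\<close> sum to zero, could be
  tested against \<open>S a\<close>.
\<close>

lemma locally_complemented_local_retraction:
  fixes F :: "'a::banach set"
  assumes F: "subspace F" and c: "0 \<le> c" and lc: "locally_complemented c F"
    and T: "finite T" "T \<subseteq> F" and \<eta>: "0 < \<eta>"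
  shows "\<exists>b\<in>F. \<forall>t\<in>T. norm (t - b) \<le> c * norm (t - a) + \<eta>"
proof (rule ccontr)
  assume contra: "\<not> ?thesis"
  obtain S :: "'a \<Rightarrow> ('a \<Rightarrow> real) \<Rightarrow> real" where S: "\<And>x. S x \<in> bidual F"
    "\<And>x y. S (x + y) = (\<lambda>f. S x f + S y f)"
    "\<And>x. bidual_norm F (S x) \<le> c * norm x"
    "\<And>x. x \<in> F \<Longrightarrow> S x = canonical_embedding F x"
    using lc unfolding locally_complemented_def by blast
  define d where "d t = c * norm (t - a) + \<eta>" for t
  have d: "0 < d t" for t using c \<eta> by (simp add: d_def add_nonneg_pos)
  have T_ne: "T \<noteq> {}" using contra subspace_0[OF F] by blast
  have far: "\<exists>t\<in>T. d t \<le> norm (t - b)" if "b \<in> F" for b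
    using contra that unfolding d_def by (meson less_imp_le not_le)
  obtain f :: "'a \<Rightarrow> 'a \<Rightarrow> real" where f: "\<And>t. linear (f t)"
    "\<And>b. b \<in> F \<Longrightarrow> (\<Sum>t\<in>T. f t b) = 0" "1 \<le> (\<Sum>t\<in>T. f t t)"
    "\<forall>u. (\<forall>t\<in>T. norm (u t) \<le> d t) \<longrightarrow> (\<Sum>t\<in>T. f t (u t)) \<le> 1"
  proof (rule separate_from_diagonal[where x = "\<lambda>t. t", OF F T(1) T_ne d far])
    fix f :: "'a \<Rightarrow> 'a \<Rightarrow> real"
    assume "\<And>t. linear (f t)" "\<And>b. b \<in> F \<Longrightarrow> (\<Sum>t\<in>T. f t b) = 0" "1 \<le> (\<Sum>t\<in>T. f t t)"
      "\<forall>u. (\<forall>t\<in>T. norm (u t) \<le> d t) \<longrightarrow> (\<Sum>t\<in>T. f t (u t)) \<le> 1"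
    then show thesis by (rule that[of f])
  qed
  \<comment> \<open>The joint bound, applied to families with a single nonzero entry, bounds each functional.\<close>
  have f_bound: "f t v \<le> 1 / d t * norm v" if t: "t \<in> T" for t v
  proof (cases "v = 0")
    case True
    then show ?thesis using linear_0[OF f(1)] by simp
  next
    case False
    define w where "w = (d t / norm v) *\<^sub>R v"
    have "(\<Sum>s\<in>T. f s (if s = t then w else 0)) \<le> 1"
      using False d[of t] by (intro f(4)[rule_format]) (auto simp: w_def less_imp_le[OF d])
    also have "(\<Sum>s\<in>T. f s (if s = t then w else 0)) = (\<Sum>s\<in>T. if s = t then f s w else 0)"
      by (intro sum.cong) (simp_all add: linear_0[OF f(1)])
    also have "\<dots> = f t w" using T(1) t by simp
    also have "\<dots> = d t / norm v * f t v" by (simp add: w_def linear_cmul[OF f(1)])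
    finally show ?thesis using d[of t] False by (simp add: field_simps)
  qed
  define g where "g t v = (if v \<in> F then f t v else 0)" for t v
  have g: "g t \<in> dual F" if "t \<in> T" for t
    unfolding g_def[abs_def] using restrict_linear_in_dual[OF F f(1) f_bound[OF that]] .
  have "(\<lambda>v. \<Sum>t\<in>T. g t v) = (\<lambda>v. \<Sum>t\<in>({}::'a set). g t v)"
  proof
    show "(\<Sum>t\<in>T. g t v) = (\<Sum>t\<in>({}::'a set). g t v)" for v
      by (cases "v \<in> F") (simp_all add: g_def f(2))
  qed
  then have Sa: "(\<Sum>t\<in>T. S a (g t)) = 0"
    using bidual_sum[where g = g, OF S(1)[of a] T(1) g] bidual_sum[OF S(1)[of a], of "{}" g] by simp
  \<comment> \<open>Since \<open>S\<close> fixes \<open>t\<close>, the left-hand side is \<open>S (t - a)\<close> evaluated at \<open>g t\<close>.\<close>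
  have S_diff: "f t t - S a (g t) \<le> c * norm (t - a) * dual_norm F (g t)" if t: "t \<in> T" for t
  proof -
    have "f t t = S t (g t)"
      using t T(2) S(4)[of t] g[OF t] by (auto simp: canonical_embedding_def g_def)
    also have "\<dots> = S (t - a) (g t) + S a (g t)"
      using fun_cong[OF S(2)[of "t - a" a], of "g t"] by simp
    finally have "f t t - S a (g t) \<le> bidual_norm F (S (t - a)) * dual_norm F (g t)"
      using bidual_le_norm[OF F S(1) g[OF t], of "t - a"] by simp
    also have "\<dots> \<le> c * norm (t - a) * dual_norm F (g t)"
      by (rule mult_right_mono[OF S(3) dual_norm_nonneg[OF F g[OF t]]])
    finally show ?thesis .
  qed
  have "1 \<le> (\<Sum>t\<in>T. f t t - S a (g t))" using f(3) Sa by (simp add: sum_subtractf)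
  also have "\<dots> \<le> (\<Sum>t\<in>T. c * norm (t - a) * dual_norm F (g t))"
    by (rule sum_mono[OF S_diff])
  finally have ge1: "1 \<le> (\<Sum>t\<in>T. c * norm (t - a) * dual_norm F (g t))" .
  \<comment> \<open>The surplus \<open>\<eta>\<close> in \<open>d t\<close> lets vectors of norm at most \<open>d t\<close> beat the terms of this sum.\<close>
  have "\<exists>u. u \<in> F \<and> norm u \<le> d t \<and> c * norm (t - a) * dual_norm F (g t) \<le> g t u \<and>
      (0 < dual_norm F (g t) \<longrightarrow> c * norm (t - a) * dual_norm F (g t) < g t u)" if "t \<in> T" for t
  proof -
    have "0 \<le> c * norm (t - a)" "c * norm (t - a) < d t" using c \<eta> by (simp_all add: d_def)
    from dual_norm_nearly_attained[OF F g[OF that] this] show ?thesis by metis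
  qed
  then obtain u where u: "\<And>t. t \<in> T \<Longrightarrow> u t \<in> F" "\<And>t. t \<in> T \<Longrightarrow> norm (u t) \<le> d t"
    "\<And>t. t \<in> T \<Longrightarrow> c * norm (t - a) * dual_norm F (g t) \<le> g t (u t)"
    "\<And>t. t \<in> T \<Longrightarrow> 0 < dual_norm F (g t) \<Longrightarrow> c * norm (t - a) * dual_norm F (g t) < g t (u t)"
    by metis
  have "\<exists>t\<in>T. 0 < dual_norm F (g t)"
  proof (rule ccontr)
    assume "\<not> ?thesis"
    then have "(\<Sum>t\<in>T. c * norm (t - a) * dual_norm F (g t)) \<le> 0"
      using c by (intro sum_nonpos) (auto simp: not_less intro: mult_nonneg_nonpos)
    with ge1 show False by simp
  qed
  then have "(\<Sum>t\<in>T. c * norm (t - a) * dual_norm F (g t)) < (\<Sum>t\<in>T. g t (u t))"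
    using u(3,4) T(1) by (intro sum_strict_mono_ex1) auto
  also have "\<dots> = (\<Sum>t\<in>T. f t (u t))" using u(1) by (intro sum.cong) (auto simp: g_def)
  also have "\<dots> \<le> 1" by (rule f(4)[rule_format, OF u(2)])
  finally show False using ge1 by simp
qed

lemma nearest_point_local_retraction:
  fixes F :: "'a::real_normed_vector set"
  assumes "F \<noteq> {}" "0 < \<eta>"
  shows "\<exists>b\<in>F. \<forall>t\<in>F. norm (t - b) \<le> 2 * norm (t - a) + \<eta>"
proof -
  have "\<exists>b\<in>F. dist a b < infdist a F + \<eta>"
    using cInf_lessD[of "dist a ` F" "infdist a F + \<eta>"] assms by (auto simp: infdist_def)
  then obtain b where b: "b \<in> F" "dist a b < infdist a F + \<eta>" by blast
  have "norm (t - b) \<le> 2 * norm (t - a) + \<eta>" if "t \<in> F" for t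
  proof -
    have "dist a b < dist a t + \<eta>" using b(2) infdist_le[OF that, of a] by simp
    moreover have "norm (t - b) \<le> norm (t - a) + norm (a - b)"
      using norm_triangle_ineq[of "t - a" "a - b"] by simp
    ultimately show ?thesis by (simp add: dist_norm norm_minus_commute)
  qed
  with b(1) show ?thesis by blast
qed

text \<open>
  Retracting a net of the compact set is enough. Moving from \<open>x\<close> to a net point \<open>t\<close> and back costs
  \<open>\<epsilon> + c * \<epsilon>\<close>, half of the tolerance; the other half is spent on the net points themselves.
\<close>

lemma compact_local_retraction:
  fixes F :: "'a::real_normed_vector set"
  assumes retr: "\<And>T a \<eta>. finite T \<Longrightarrow> T \<subseteq> F \<Longrightarrow> 0 < \<eta> \<Longrightarrow>
                   \<exists>b\<in>F. \<forall>t\<in>T. norm (t - b) \<le> c * norm (t - a) + \<eta>"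
    and c: "0 \<le> c" and K: "compact K" "K \<subseteq> F" and \<delta>: "0 < \<delta>"
  shows "\<exists>b\<in>F. \<forall>x\<in>K. norm (x - b) \<le> c * norm (x - a) + \<delta>"
proof -
  define \<epsilon> where "\<epsilon> = \<delta> / (2 * (1 + c))"
  have \<epsilon>: "0 < \<epsilon>" "\<epsilon> + c * \<epsilon> = \<delta> / 2"
  proof -
    show "0 < \<epsilon>" using c \<delta> by (simp add: \<epsilon>_def)
    have "\<delta> / (2 * s) * s = \<delta> / 2" if "s \<noteq> 0" for s using that by simp
    from this[of "1 + c"] have "\<epsilon> * (1 + c) = \<delta> / 2" using c by (simp only: \<epsilon>_def)
    then show "\<epsilon> + c * \<epsilon> = \<delta> / 2" by (simp add: algebra_simps)
  qed
  have "K \<subseteq> (\<Union>x\<in>K. ball x \<epsilon>)" using \<epsilon>(1) by auto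
  then obtain T where T: "T \<subseteq> K" "finite T" "K \<subseteq> (\<Union>x\<in>T. ball x \<epsilon>)"
    by (rule compactE_image[OF K(1), rotated]) auto
  obtain b where b: "b \<in> F" "\<forall>t\<in>T. norm (t - b) \<le> c * norm (t - a) + \<delta> / 2"
    using retr[OF T(2), of "\<delta> / 2" a] T(1) K(2) \<delta> by auto
  have "norm (x - b) \<le> c * norm (x - a) + \<delta>" if "x \<in> K" for x
  proof -
    obtain t where t: "t \<in> T" "norm (x - t) < \<epsilon>"
      using T(3) \<open>x \<in> K\<close> by (auto simp: dist_norm norm_minus_commute)
    have "norm (x - b) \<le> norm (x - t) + norm (t - b)"
      using norm_triangle_ineq[of "x - t" "t - b"] by simp
    also have "\<dots> \<le> \<epsilon> + (c * norm (t - a) + \<delta> / 2)" using t b(2) by (intro add_mono) auto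
    also have "norm (t - a) \<le> norm (x - a) + \<epsilon>"
      using norm_triangle_ineq[of "t - x" "x - a"] t(2) by (simp add: norm_minus_commute)
    finally have "norm (x - b) \<le> \<epsilon> + (c * (norm (x - a) + \<epsilon>) + \<delta> / 2)"
      using c by (simp add: mult_left_mono)
    then show ?thesis using \<epsilon>(2) by (simp add: distrib_left)
  qed
  with b(1) show ?thesis by blast
qed

section \<open>Transferring codebooks into the subspace\<close>

text \<open>
  Inner regularity gives compact subsets of \<open>F\<close> of measure close to \<open>1\<close>. Their finite unions increase,
  so membership in one of them persists from then on.
\<close>

lemma radon_exhausting_compacts:
  fixes F :: "'a::banach set"
  assumes \<mu>: "radon_prob_measure \<mu>" and F: "closed F" "measure \<mu> F = 1"
  obtains K :: "nat \<Rightarrow> 'a set" where "\<And>k. compact (K k)" "\<And>k. K k \<subseteq> F"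
    "AE x in \<mu>. \<forall>\<^sub>F k in sequentially. x \<in> K k"
proof -
  interpret prob_space \<mu> using \<mu> by (simp add: radon_prob_measure_def)
  have sets: "sets \<mu> = sets borel" using \<mu> by (simp add: radon_prob_measure_def)
  have F_borel: "F \<in> sets borel" using F(1) by simp
  then have "emeasure \<mu> F = (SUP K\<in>{K. compact K \<and> K \<subseteq> F}. emeasure \<mu> K)"
    using \<mu> unfolding radon_prob_measure_def by blast
  then have SUP: "(SUP K\<in>{K. compact K \<and> K \<subseteq> F}. emeasure \<mu> K) = 1"
    using F(2) by (simp add: emeasure_eq_measure)
  have "\<exists>K. compact K \<and> K \<subseteq> F \<and> 1 - 1 / Suc k < measure \<mu> K" for k
  proof -
    have "ennreal (1 - 1 / Suc k) < 1"
      by (simp add: ennreal_less_one_iff)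
    then obtain K where "compact K" "K \<subseteq> F" "ennreal (1 - 1 / Suc k) < emeasure \<mu> K"
      unfolding SUP[symmetric] less_SUP_iff by blast
    then show ?thesis by (auto simp: emeasure_eq_measure ennreal_less_iff)
  qed
  then obtain K where K: "\<And>k. compact (K k)" "\<And>k. K k \<subseteq> F"
    "\<And>k. 1 - 1 / Suc k < measure \<mu> (K k)" by metis
  have meas: "K k \<in> sets \<mu>" for k using K(1)[of k] by (simp add: sets borel_compact)
  have "measure \<mu> (\<Union>k. K k) = 1"
  proof (rule antisym)
    show "1 \<le> measure \<mu> (\<Union>k. K k)"
    proof (rule LIMSEQ_le_const2)
      show "(\<lambda>k. 1 - 1 / real (Suc k)) \<longlonglongrightarrow> 1"
        using tendsto_diff[OF tendsto_const LIMSEQ_Suc[OF lim_1_over_n], of 1] by simp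
      have "1 - 1 / Suc k \<le> measure \<mu> (\<Union>k. K k)" for k
        using K(3)[of k] finite_measure_mono[of "K k" "\<Union>k. K k"] meas by fastforce
      then show "\<exists>N. \<forall>k\<ge>N. 1 - 1 / real (Suc k) \<le> measure \<mu> (\<Union>k. K k)" by blast
    qed
  qed simp
  then have "AE x in \<mu>. x \<in> (\<Union>k. K k)" using meas by (subst AE_in_set_eq_1) auto
  then have ev: "AE x in \<mu>. \<forall>\<^sub>F k in sequentially. x \<in> (\<Union>i\<le>k. K i)"
    by (rule eventually_mono) (auto simp: eventually_sequentially)
  show ?thesis
    by (rule that[of "\<lambda>k. \<Union>i\<le>k. K i", OF _ _ ev]) (use K in auto)
qed

text \<open>
  For \<open>r < 1\<close> the power is not convex, so the estimate bounds the sum by twice the larger summand,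
  which works for every \<open>r > 0\<close>.
\<close>

lemma integrable_affine_powr:
  fixes Y :: "'w \<Rightarrow> real"
  assumes [measurable]: "Y \<in> borel_measurable M" and fin: "finite_measure M"
    and int: "integrable M (\<lambda>\<omega>. Y \<omega> powr r)"
    and nonneg: "\<And>\<omega>. 0 \<le> Y \<omega>" "0 \<le> s" "0 \<le> R" "0 < r"
  shows "integrable M (\<lambda>\<omega>. (s * Y \<omega> + R) powr r)"
proof (rule Bochner_Integration.integrable_bound)
  interpret finite_measure M by fact
  show "integrable M (\<lambda>\<omega>. 2 powr r * (s powr r * Y \<omega> powr r + R powr r))"
    using int by simp
  show "AE \<omega> in M. norm ((s * Y \<omega> + R) powr r) \<le> norm (2 powr r * (s powr r * Y \<omega> powr r + R powr r))"
  proof (rule AE_I2)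
    fix \<omega>
    have "(s * Y \<omega> + R) powr r \<le> (2 * max (s * Y \<omega>) R) powr r"
      using nonneg by (intro powr_mono2) auto
    also have "\<dots> = 2 powr r * max (s * Y \<omega>) R powr r"
      using nonneg by (simp add: powr_mult)
    also have "max (s * Y \<omega>) R powr r \<le> (s * Y \<omega>) powr r + R powr r" by (simp add: max_def)
    also have "(s * Y \<omega>) powr r = s powr r * Y \<omega> powr r" using nonneg by (simp add: powr_mult)
    finally show "norm ((s * Y \<omega> + R) powr r) \<le> norm (2 powr r * (s powr r * Y \<omega> powr r + R powr r))"
      by simp
  qed
qed simp

text \<open>
  Fix a codebook \<open>\<alpha>\<close> in the ambient space and let \<open>Y\<close> be the distance of \<open>X\<close> to \<open>\<alpha>\<close>. Moving each \<open>a\<close> in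
  \<open>\<alpha>\<close> into \<open>F\<close> by a retraction for the \<open>k\<close>-th compact set \<open>K k\<close> yields a codebook whose distance to \<open>X\<close>
  is at most \<open>c * Y + \<delta> k\<close> where \<open>X\<close> lies in \<open>K k\<close>; elsewhere the \<open>r\<close>-th power of this distance is at
  most a fixed integrable function \<open>h\<close>. The sum \<open>u k\<close> of the two bounds on the \<open>r\<close>-th
  power tends to \<open>(c * Y) powr r\<close> almost surely, and dominated convergence passes to the expectations.
\<close>

lemma quantization_error_le_of_local_retraction:
  fixes M :: "'w measure" and X :: "'w \<Rightarrow> 'a::banach" and F :: "'a set"
  assumes r: "0 < r" and X: "radon_random_variable M X"
    and int: "integrable M (\<lambda>\<omega>. norm (X \<omega>) powr r)"
    and F: "banach_subspace F" "measure (distr M borel X) F = 1"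
    and c: "0 < c" and n: "1 \<le> n"
    and retr: "\<And>T a \<eta>. finite T \<Longrightarrow> T \<subseteq> F \<Longrightarrow> 0 < \<eta> \<Longrightarrow>
                 \<exists>b\<in>F. \<forall>t\<in>T. norm (t - b) \<le> c * norm (t - a) + \<eta>"
  shows "quantization_error M n r X F \<le> c * quantization_error M n r X UNIV"
proof -
  interpret prob_space M using X by (simp add: radon_random_variable_def)
  have X_meas [measurable]: "X \<in> borel_measurable M" using X by (simp add: radon_random_variable_def)
  have F': "subspace F" "closed F" using F(1) by (auto simp: banach_subspace_def)
  obtain K where K: "\<And>k. compact (K k)" "\<And>k. K k \<subseteq> F"
    and AE_K: "AE x in distr M borel X. \<forall>\<^sub>F k in sequentially. x \<in> K k"
    using radon_exhausting_compacts[OF _ F'(2) F(2)] X by (auto simp: radon_random_variable_def)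
  have AE_K: "AE \<omega> in M. \<forall>\<^sub>F k in sequentially. X \<omega> \<in> K k"
    using AE_distrD[OF X_meas AE_K] .
  have K_borel [measurable]: "K k \<in> sets borel" for k using K(1) by (rule borel_compact)
  define D where "D \<alpha> x = Min ((\<lambda>a. norm (x - a) powr r) ` \<alpha>)" for \<alpha> :: "'a set" and x
  have D_le: "D \<alpha> x \<le> norm (x - a) powr r" if "finite \<alpha>" "a \<in> \<alpha>" for \<alpha> a x
    unfolding D_def using that by simp
  have D_attained: "\<exists>a\<in>\<alpha>. D \<alpha> x = norm (x - a) powr r" if "finite \<alpha>" "\<alpha> \<noteq> {}" for \<alpha> x
    using Min_in[of "(\<lambda>a. norm (x - a) powr r) ` \<alpha>"] that unfolding D_def by blast
  have D_nonneg: "0 \<le> D \<alpha> x" if "finite \<alpha>" "\<alpha> \<noteq> {}" for \<alpha> x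
    using D_attained[OF that, of x] by auto
  have D_meas [measurable]: "(\<lambda>\<omega>. D \<alpha> (X \<omega>)) \<in> borel_measurable M" if "finite \<alpha>" for \<alpha>
  proof -
    have "(\<lambda>\<omega>. norm (X \<omega> - a)) \<in> borel_measurable M" for a
    proof (rule measurable_compose[OF X_meas])
      show "(\<lambda>x. norm (x - a)) \<in> borel_measurable borel"
        by (intro borel_measurable_continuous_onI continuous_intros)
    qed
    then show ?thesis unfolding D_def using that by measurable
  qed
  have D_int: "integrable M (\<lambda>\<omega>. D \<alpha> (X \<omega>))" if \<alpha>: "finite \<alpha>" "\<alpha> \<noteq> {}" for \<alpha>
  proof -
    obtain a where a: "a \<in> \<alpha>" using \<alpha> by blast
    show ?thesis
    proof (rule Bochner_Integration.integrable_bound)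
      show "integrable M (\<lambda>\<omega>. (1 * norm (X \<omega>) + norm a) powr r)"
        by (rule integrable_affine_powr[OF _ _ int]) (use r in \<open>auto intro: finite_measure_axioms\<close>)
      show "AE \<omega> in M. norm (D \<alpha> (X \<omega>)) \<le> norm ((1 * norm (X \<omega>) + norm a) powr r)"
      proof (rule AE_I2)
        fix \<omega>
        have "norm (X \<omega> - a) powr r \<le> (norm (X \<omega>) + norm a) powr r"
          using r by (intro powr_mono2 norm_triangle_ineq4) auto
        then show "norm (D \<alpha> (X \<omega>)) \<le> norm ((1 * norm (X \<omega>) + norm a) powr r)"
          using D_le[OF \<alpha>(1) a, of "X \<omega>"] D_nonneg[OF \<alpha>, of "X \<omega>"] by simp
      qed
    qed (use D_meas \<alpha> in simp)
  qed
  have qe: "quantization_error M n r X G =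
      (INF \<alpha>\<in>{\<alpha>. \<alpha> \<subseteq> G \<and> 1 \<le> card \<alpha> \<and> card \<alpha> \<le> n}. (\<integral>\<omega>. D \<alpha> (X \<omega>) \<partial>M) powr (1 / r))" for G
    unfolding quantization_error_def D_def ..
  have bdd: "bdd_below ((\<lambda>\<alpha>. (\<integral>\<omega>. D \<alpha> (X \<omega>) \<partial>M) powr (1 / r)) ` A)" for A
    by (intro bdd_belowI2[of _ 0]) simp
  show ?thesis unfolding qe[of UNIV]
  proof (rule le_mult_cINF[OF _ c])
    show "{\<alpha>::'a set. \<alpha> \<subseteq> UNIV \<and> 1 \<le> card \<alpha> \<and> card \<alpha> \<le> n} \<noteq> {}"
      using n by (auto intro!: exI[of _ "{0}"])
    fix \<alpha> :: "'a set" assume "\<alpha> \<in> {\<alpha>. \<alpha> \<subseteq> UNIV \<and> 1 \<le> card \<alpha> \<and> card \<alpha> \<le> n}"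
    then have card: "1 \<le> card \<alpha>" "card \<alpha> \<le> n" by auto
    then have \<alpha>: "finite \<alpha>" "\<alpha> \<noteq> {}" by (auto intro: card_ge_0_finite)
    obtain a0 where a0: "a0 \<in> \<alpha>" using \<alpha> by blast
    define Y where "Y \<omega> = D \<alpha> (X \<omega>) powr (1 / r)" for \<omega>
    have Y_meas [measurable]: "Y \<in> borel_measurable M" unfolding Y_def[abs_def] using D_meas \<alpha> by simp
    have Y_powr: "Y \<omega> powr r = D \<alpha> (X \<omega>)" for \<omega>
      using r D_nonneg[OF \<alpha>] by (simp add: Y_def powr_powr)
    have Y_attained: "\<exists>a\<in>\<alpha>. Y \<omega> = norm (X \<omega> - a)" for \<omega>
      using D_attained[OF \<alpha>, of "X \<omega>"] r by (auto simp: Y_def powr_powr)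
    \<comment> \<open>One point \<open>a0\<close> of the codebook suffices off the compact sets: its image has norm at most
      \<open>c * norm a0 + 1\<close> for every \<open>k\<close>.\<close>
    define h where "h \<omega> = (1 * norm (X \<omega>) + (c * norm a0 + 1)) powr r" for \<omega>
    define \<delta> where "\<delta> k = 1 / real (Suc k)" for k
    have \<delta>: "0 < \<delta> k" "\<delta> k \<le> 1" for k by (simp_all add: \<delta>_def)
    define u where "u k \<omega> = (c * Y \<omega> + \<delta> k) powr r + indicator (- K k) (X \<omega>) * h \<omega>" for k \<omega>
    have h_int: "integrable M h" unfolding h_def[abs_def]
      by (rule integrable_affine_powr[OF _ _ int]) (use r c in \<open>auto intro: finite_measure_axioms\<close>)
    have "integrable M (\<lambda>\<omega>. (c * Y \<omega> + 1) powr r)"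
      by (rule integrable_affine_powr)
        (use r c D_int[OF \<alpha>] in \<open>auto simp: Y_powr intro: finite_measure_axioms, simp add: Y_def\<close>)
    then have dom_int: "integrable M (\<lambda>\<omega>. (c * Y \<omega> + 1) powr r + h \<omega>)" using h_int by simp
    have Y_nonneg: "0 \<le> Y \<omega>" for \<omega> by (simp add: Y_def)
    have h_nonneg: "0 \<le> h \<omega>" for \<omega> by (simp add: h_def)
    have h_meas [measurable]: "h \<in> borel_measurable M" using h_int by simp
    have u_meas [measurable]: "u k \<in> borel_measurable M" for k
      unfolding u_def[abs_def] by measurable
    have u_le: "AE \<omega> in M. norm (u k \<omega>) \<le> (c * Y \<omega> + 1) powr r + h \<omega>" for k
    proof (rule AE_I2)
      fix \<omega>
      have "(c * Y \<omega> + \<delta> k) powr r \<le> (c * Y \<omega> + 1) powr r"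
        using r c Y_nonneg[of \<omega>] \<delta>[of k] by (intro powr_mono2) auto
      moreover have "indicator (- K k) (X \<omega>) * h \<omega> \<le> h \<omega>"
        using h_nonneg[of \<omega>] by (simp add: indicator_def)
      ultimately show "norm (u k \<omega>) \<le> (c * Y \<omega> + 1) powr r + h \<omega>"
        using h_nonneg[of \<omega>] by (simp add: u_def)
    qed
    have \<delta>_lim: "\<delta> \<longlonglongrightarrow> 0" unfolding \<delta>_def[abs_def] by (rule LIMSEQ_Suc[OF lim_1_over_n])
    have u_lim: "AE \<omega> in M. (\<lambda>k. u k \<omega>) \<longlonglongrightarrow> c powr r * D \<alpha> (X \<omega>)"
      using AE_K
    proof (rule eventually_mono)
      fix \<omega> assume ev: "\<forall>\<^sub>F k in sequentially. X \<omega> \<in> K k"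
      have "(\<lambda>k. indicator (- K k) (X \<omega>) * h \<omega>) \<longlonglongrightarrow> 0"
        by (rule tendsto_eventually) (use ev in eventually_elim, simp)
      moreover have "(\<lambda>k. (c * Y \<omega> + \<delta> k) powr r) \<longlonglongrightarrow> (c * Y \<omega> + 0) powr r"
        by (rule tendsto_powr'[OF tendsto_add[OF tendsto_const \<delta>_lim] tendsto_const])
          (use r c Y_nonneg[of \<omega>] \<delta>(1) in \<open>auto intro!: always_eventually add_nonneg_nonneg less_imp_le\<close>)
      ultimately have "(\<lambda>k. u k \<omega>) \<longlonglongrightarrow> (c * Y \<omega> + 0) powr r + 0"
        unfolding u_def by (intro tendsto_add)
      then show "(\<lambda>k. u k \<omega>) \<longlonglongrightarrow> c powr r * D \<alpha> (X \<omega>)"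
        using c Y_nonneg[of \<omega>] by (simp add: powr_mult Y_powr)
    qed
    have lim: "(\<lambda>k. \<integral>\<omega>. u k \<omega> \<partial>M) \<longlonglongrightarrow> (\<integral>\<omega>. c powr r * D \<alpha> (X \<omega>) \<partial>M)"
      by (rule integral_dominated_convergence[OF _ u_meas dom_int u_lim u_le])
        (use D_meas[OF \<alpha>(1)] in simp)
    have u_int: "integrable M (u k)" for k
      by (rule Bochner_Integration.integrable_bound[OF dom_int u_meas])
        (use u_le[of k] in eventually_elim, auto)
    have u_nonneg: "0 \<le> u k \<omega>" for k \<omega> using h_nonneg[of \<omega>] by (simp add: u_def)
    have le: "quantization_error M n r X F \<le> (\<integral>\<omega>. u k \<omega> \<partial>M) powr (1 / r)" for k
    proof -
      \<comment> \<open>Including \<open>0\<close> bounds the moved points uniformly in \<open>k\<close>.\<close>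
      have "\<exists>b\<in>F. \<forall>x\<in>insert 0 (K k). norm (x - b) \<le> c * norm (x - a) + \<delta> k" for a
        by (rule compact_local_retraction[OF retr])
          (use c K[of k] \<delta>(1)[of k] subspace_0[OF F'(1)] in auto)
      then obtain b where b: "\<And>a. b a \<in> F"
        "\<And>a x. x \<in> insert 0 (K k) \<Longrightarrow> norm (x - b a) \<le> c * norm (x - a) + \<delta> k" by metis
      have D_b: "D (b ` \<alpha>) (X \<omega>) \<le> u k \<omega>" for \<omega>
      proof (cases "X \<omega> \<in> K k")
        case True
        obtain a where a: "a \<in> \<alpha>" "Y \<omega> = norm (X \<omega> - a)" using Y_attained by blast
        have "D (b ` \<alpha>) (X \<omega>) \<le> norm (X \<omega> - b a) powr r" using \<alpha> a(1) by (intro D_le) auto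
        also have "\<dots> \<le> (c * Y \<omega> + \<delta> k) powr r"
          using r b(2)[of "X \<omega>" a] True a(2) by (intro powr_mono2) auto
        also have "\<dots> \<le> u k \<omega>" using h_nonneg[of \<omega>] by (simp add: u_def)
        finally show ?thesis .
      next
        case False
        have "norm (b a0) \<le> c * norm a0 + 1" using b(2)[of 0 a0] \<delta>(2)[of k] by simp
        then have "norm (X \<omega> - b a0) \<le> 1 * norm (X \<omega>) + (c * norm a0 + 1)"
          using norm_triangle_ineq4[of "X \<omega>" "b a0"] by linarith
        then have "norm (X \<omega> - b a0) powr r \<le> h \<omega>" unfolding h_def using r by (intro powr_mono2) auto
        moreover have "D (b ` \<alpha>) (X \<omega>) \<le> norm (X \<omega> - b a0) powr r"
          using \<alpha> a0 by (intro D_le) auto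
        ultimately have "D (b ` \<alpha>) (X \<omega>) \<le> h \<omega>" by linarith
        also have "\<dots> \<le> u k \<omega>" using False by (simp add: u_def)
        finally show ?thesis .
      qed
      have "quantization_error M n r X F \<le> (\<integral>\<omega>. D (b ` \<alpha>) (X \<omega>) \<partial>M) powr (1 / r)"
        unfolding qe
      proof (rule cINF_lower[OF bdd])
        have "card (b ` \<alpha>) \<le> n" using card_image_le[OF \<alpha>(1), of b] card(2) by simp
        moreover have "1 \<le> card (b ` \<alpha>)" using \<alpha> by (simp add: Suc_le_eq card_gt_0_iff)
        ultimately show "b ` \<alpha> \<in> {\<alpha>. \<alpha> \<subseteq> F \<and> 1 \<le> card \<alpha> \<and> card \<alpha> \<le> n}" using b(1) by auto
      qed
      also have "\<dots> \<le> (\<integral>\<omega>. u k \<omega> \<partial>M) powr (1 / r)"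
      proof (rule powr_mono2)
        show "(\<integral>\<omega>. D (b ` \<alpha>) (X \<omega>) \<partial>M) \<le> (\<integral>\<omega>. u k \<omega> \<partial>M)"
          using \<alpha> by (intro integral_mono D_int u_int D_b) auto
        show "0 \<le> (\<integral>\<omega>. D (b ` \<alpha>) (X \<omega>) \<partial>M)"
          using \<alpha> by (intro integral_nonneg_AE AE_I2 D_nonneg) auto
      qed (use r in simp)
      finally show ?thesis .
    qed
    have "(\<lambda>k. (\<integral>\<omega>. u k \<omega> \<partial>M) powr (1 / r))
        \<longlonglongrightarrow> (\<integral>\<omega>. c powr r * D \<alpha> (X \<omega>) \<partial>M) powr (1 / r)"
      by (rule tendsto_powr'[OF lim tendsto_const])
        (use r u_nonneg in \<open>auto intro!: always_eventually integral_nonneg_AE\<close>)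
    then have "quantization_error M n r X F \<le> (\<integral>\<omega>. c powr r * D \<alpha> (X \<omega>) \<partial>M) powr (1 / r)"
      by (rule LIMSEQ_le_const) (use le in blast)
    also have "\<dots> = c * (\<integral>\<omega>. D \<alpha> (X \<omega>) \<partial>M) powr (1 / r)"
      using r c \<alpha> by (simp add: powr_mult powr_powr integral_nonneg_AE D_nonneg)
    finally show "quantization_error M n r X F \<le> c * (\<integral>\<omega>. D \<alpha> (X \<omega>) \<partial>M) powr (1 / r)" .
  qed
qed

lemma quantization_error_mono:
  assumes "F \<noteq> {}" "1 \<le> n" "F \<subseteq> G"
  shows "quantization_error M n r X G \<le> quantization_error M n r X F"
  unfolding quantization_error_def
proof (rule cINF_superset_mono)
  obtain x where "x \<in> F" using assms(1) by blast
  then show "{\<alpha>. \<alpha> \<subseteq> F \<and> 1 \<le> card \<alpha> \<and> card \<alpha> \<le> n} \<noteq> {}"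
    using assms(2) by (auto intro!: exI[of _ "{x}"])
qed (use assms(3) in \<open>auto intro!: bdd_belowI2[of _ 0]\<close>)

theorem proposition3:
  fixes M :: "'w measure" and X :: "'w \<Rightarrow> 'a::banach" and F :: "'a set" and r :: real
  assumes "0 < r"
    and "radon_random_variable M X"
    and "integrable M (\<lambda>\<omega>. norm (X \<omega>) powr r)"
    and "banach_subspace F"
    and "measure (distr M borel X) F = 1"
  shows "(\<forall>n\<ge>1. quantization_error M n r X UNIV \<le> quantization_error M n r X F \<and>
                 quantization_error M n r X F \<le> 2 * quantization_error M n r X UNIV) \<and>
         (\<forall>c\<ge>1. locally_complemented c F \<longrightarrow>
            (\<forall>n\<ge>1. quantization_error M n r X F \<le> c * quantization_error M n r X UNIV))"
proof (intro conjI allI impI)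
  have F: "subspace F" using assms(4) by (simp add: banach_subspace_def)
  have F_ne: "F \<noteq> {}" using subspace_0[OF F] by blast
  fix n :: nat assume n: "1 \<le> n"
  show "quantization_error M n r X UNIV \<le> quantization_error M n r X F"
    by (rule quantization_error_mono[OF F_ne n]) simp
  show "quantization_error M n r X F \<le> 2 * quantization_error M n r X UNIV"
  proof (rule quantization_error_le_of_local_retraction[OF assms _ n])
    fix T a and \<eta> :: real assume "T \<subseteq> F" "0 < \<eta>"
    then show "\<exists>b\<in>F. \<forall>t\<in>T. norm (t - b) \<le> 2 * norm (t - a) + \<eta>"
      using nearest_point_local_retraction[OF F_ne, of \<eta> a] by blast
  qed simp
next
  have F: "subspace F" using assms(4) by (simp add: banach_subspace_def)
  fix c :: real and n :: nat assume c: "1 \<le> c" "locally_complemented c F" and n: "1 \<le> n"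
  show "quantization_error M n r X F \<le> c * quantization_error M n r X UNIV"
  proof (rule quantization_error_le_of_local_retraction[OF assms _ n])
    show "\<exists>b\<in>F. \<forall>t\<in>T. norm (t - b) \<le> c * norm (t - a) + \<eta>"
      if "finite T" "T \<subseteq> F" "0 < \<eta>" for T a \<eta>
      using locally_complemented_local_retraction[OF F _ c(2) that] c(1) by simp
  qed (use c in simp)
qed

end
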